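(* Let $(S,+)$ be a commutative semigroup, let $E_1$ be a complex normed space, and let $\psi:S^2\to[0,\infty)$ be a function such that $$\lim_{n\to\infty}\frac1n\sum_{i=0}^{n-1}\psi(x+ix_0,x_0)=0\quad\text{and}\quad \lim_{n\to\infty}\frac1n\,\psi(x+nx_0,y+ny_0)=0$$ for all $x_0,y_0,x,y\in S$. Then every function $f:S\to E_1$ satisfying $$\|f(x+y)-f(x)-f(y)\|\le\psi(x,y)\quad\text{for all }x,y\in S$$ satisfies $f(x+y)=f(x)+f(y)$ for all $x,y\in S$.
   Context: For $x_0\in S$ and a positive integer $n$, $nx_0$ is the $n$-fold sum of $x_0$ in $S$; by convention $x+0x_0$ means $x$ (the semigroup need not have an identity). *)

theory Defs
  imports Complex_Main
begin

(* The metric and the topology come from real_normed_vector; scaleR_scaleC says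
   that the real vector space structure is the restriction of the complex one. *)
class complex_normed_space = real_normed_vector +
  fixes scaleC :: "complex \<Rightarrow> 'a \<Rightarrow> 'a"
  assumes scaleC_add_right: "scaleC a (x + y) = scaleC a x + scaleC a y"
    and scaleC_add_left: "scaleC (a + b) x = scaleC a x + scaleC b x"
    and scaleC_scaleC: "scaleC a (scaleC b x) = scaleC (a * b) x"
    and scaleC_one: "scaleC 1 x = x"
    and scaleR_scaleC: "r *\<^sub>R x = scaleC (complex_of_real r) x"
    and norm_scaleC: "norm (scaleC a x) = cmod a * norm x"

instantiation complex :: complex_normed_space
begin

definition scaleC_complex :: "complex \<Rightarrow> complex \<Rightarrow> complex" where
  "scaleC_complex a x = a * x"

instance
  by standard (simp_all add: scaleC_complex_def algebra_simps norm_mult scaleR_conv_of_real)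

end

(* The n-fold sum x + ... + x for n \<ge> 1; the value at n = 0 is not meaningful,
   since a semigroup need not have an identity. *)
definition nfold_sum :: "nat \<Rightarrow> 'a::semigroup_add \<Rightarrow> 'a" where
  "nfold_sum n x = ((\<lambda>z. z + x) ^^ (n - 1)) x"

(* x + n x0, with the convention that x + 0 x0 means x. *)
definition plus_nfold :: "'a::semigroup_add \<Rightarrow> nat \<Rightarrow> 'a \<Rightarrow> 'a" where
  "plus_nfold x n x\<^sub>0 = (if n = 0 then x else x + nfold_sum n x\<^sub>0)"

end

theory Submission
  imports Defs
begin

text \<open>
  Telescoping the increments \<open>f (x + i x\<^sub>0 + x\<^sub>0) - f (x + i x\<^sub>0)\<close> and using the first limit,
  \<open>f (x + n x\<^sub>0) / n\<close> tends to \<open>f x\<^sub>0\<close>. Since \<open>(x + n x\<^sub>0) + (y + n y\<^sub>0) = (x + y) + n (x\<^sub>0 + y\<^sub>0)\<close>,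
  the Cauchy difference of \<open>f\<close> at \<open>(x + n x\<^sub>0, y + n y\<^sub>0)\<close>, divided by \<open>n\<close>, tends to the Cauchy
  difference at \<open>(x\<^sub>0, y\<^sub>0)\<close>, while the second limit makes it tend to 0.
\<close>

lemma plus_nfold_0 [simp]: "plus_nfold x 0 x\<^sub>0 = x"
  by (simp add: plus_nfold_def)

text \<open>Associativity merges the convention at 0 and the iterated sum into one recursion, so
  later inductions need no case split.\<close>

lemma plus_nfold_Suc [simp]: "plus_nfold x (Suc n) x\<^sub>0 = plus_nfold x n x\<^sub>0 + x\<^sub>0"
  by (cases n) (simp_all add: plus_nfold_def nfold_sum_def add.assoc)

text \<open>Commutativity enters here: each induction step moves \<open>x\<^sub>0\<close> past the
  y-part.\<close>

lemma plus_nfold_add: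
  fixes x y :: "'s::ab_semigroup_add"
  shows "plus_nfold x n x\<^sub>0 + plus_nfold y n y\<^sub>0 = plus_nfold (x + y) n (x\<^sub>0 + y\<^sub>0)"
proof (induction n)
  case (Suc n)
  have "plus_nfold x (Suc n) x\<^sub>0 + plus_nfold y (Suc n) y\<^sub>0
      = (plus_nfold x n x\<^sub>0 + plus_nfold y n y\<^sub>0) + (x\<^sub>0 + y\<^sub>0)"
    by (simp add: ac_simps)
  with Suc show ?case by simp
qed simp

text \<open>Each of the n additions of \<open>x\<^sub>0\<close> costs one value of \<psi>; the
  triangle inequality collects them.\<close>

lemma norm_plus_nfold_le:
  fixes f :: "'s::semigroup_add \<Rightarrow> 'e::real_normed_vector"
  assumes "\<And>x y. norm (f (x + y) - f x - f y) \<le> \<psi> x y"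
  shows "norm (f (plus_nfold x n x\<^sub>0) - f x - real n *\<^sub>R f x\<^sub>0) \<le> (\<Sum>i<n. \<psi> (plus_nfold x i x\<^sub>0) x\<^sub>0)"
proof (induction n)
  case (Suc n)
  let ?p = "plus_nfold x n x\<^sub>0"
  have "f (?p + x\<^sub>0) - f x - real (Suc n) *\<^sub>R f x\<^sub>0
      = (f ?p - f x - real n *\<^sub>R f x\<^sub>0) + (f (?p + x\<^sub>0) - f ?p - f x\<^sub>0)"
    by (simp add: algebra_simps)
  also have "norm \<dots> \<le> (\<Sum>i<n. \<psi> (plus_nfold x i x\<^sub>0) x\<^sub>0) + \<psi> ?p x\<^sub>0"
    by (intro norm_triangle_mono Suc.IH assms)
  finally show ?case by simp
qed simp

lemma tendsto_plus_nfold: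
  fixes f :: "'s::semigroup_add \<Rightarrow> 'e::real_normed_vector"
  assumes f_bound: "\<And>x y. norm (f (x + y) - f x - f y) \<le> \<psi> x y"
    and lim: "(\<lambda>n. 1 / real n * (\<Sum>i<n. \<psi> (plus_nfold x i x\<^sub>0) x\<^sub>0)) \<longlonglongrightarrow> 0"
  shows "(\<lambda>n. (1 / real n) *\<^sub>R f (plus_nfold x n x\<^sub>0)) \<longlonglongrightarrow> f x\<^sub>0"
proof -
  let ?d = "\<lambda>n. (1 / real n) *\<^sub>R (f (plus_nfold x n x\<^sub>0) - f x - real n *\<^sub>R f x\<^sub>0)"
  have d: "?d \<longlonglongrightarrow> 0"
  proof (rule tendsto_0_le[where K = 1, OF lim always_eventually], rule allI)
    fix n
    show "norm (?d n) \<le> norm (1 / real n * (\<Sum>i<n. \<psi> (plus_nfold x i x\<^sub>0) x\<^sub>0)) * 1"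
      using order.trans[OF norm_plus_nfold_le[OF f_bound] abs_ge_self]
      by (simp add: abs_mult divide_right_mono)
  qed
  have "(\<lambda>n. (1 / real n) *\<^sub>R f x) \<longlonglongrightarrow> 0 *\<^sub>R f x"
    by (intro tendsto_scaleR lim_1_over_n tendsto_const)
  from tendsto_add[OF tendsto_add[OF d this] tendsto_const[of "f x\<^sub>0"]]
  have "(\<lambda>n. ?d n + (1 / real n) *\<^sub>R f x + f x\<^sub>0) \<longlonglongrightarrow> f x\<^sub>0"
    by simp
  \<comment> \<open>Cancelling \<open>real n\<close> requires n > 0: since 1 / 0 = 0, at n = 0 the
    left side is \<open>f x\<^sub>0\<close> and the right side is 0.\<close>
  moreover have "\<forall>\<^sub>F n in sequentially.
      ?d n + (1 / real n) *\<^sub>R f x + f x\<^sub>0 = (1 / real n) *\<^sub>R f (plus_nfold x n x\<^sub>0)"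
    using eventually_gt_at_top[of 0] by eventually_elim (simp add: algebra_simps)
  ultimately show ?thesis
    by (rule Lim_transform_eventually)
qed

theorem theorem4p1:
  fixes \<psi> :: "'s::ab_semigroup_add \<Rightarrow> 's \<Rightarrow> real"
    and f :: "'s \<Rightarrow> 'e::complex_normed_space"
  assumes psi_nonneg: "\<And>x y. 0 \<le> \<psi> x y"
    and lim_avg: "\<And>x\<^sub>0 x. (\<lambda>n. 1 / real n * (\<Sum>i<n. \<psi> (plus_nfold x i x\<^sub>0) x\<^sub>0)) \<longlonglongrightarrow> 0"
    and lim_psi: "\<And>x\<^sub>0 y\<^sub>0 x y.
      (\<lambda>n. 1 / real n * \<psi> (plus_nfold x n x\<^sub>0) (plus_nfold y n y\<^sub>0)) \<longlonglongrightarrow> 0"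
    and f_bound: "\<And>x y. norm (f (x + y) - f x - f y) \<le> \<psi> x y"
  shows "\<forall>x y. f (x + y) = f x + f y"
proof (intro allI)
  fix x y :: 's
  \<comment> \<open>Base points are free in both limits. With each equal to its increment,
    \<open>?X n + ?Y n\<close> is (x + y) + n(x + y), so \<open>lim\<close> below serves all three
    terms of \<open>?c\<close>.\<close>
  let ?X = "\<lambda>n. plus_nfold x n x" and ?Y = "\<lambda>n. plus_nfold y n y"
  let ?c = "\<lambda>n. (1 / real n) *\<^sub>R (f (?X n + ?Y n) - f (?X n) - f (?Y n))"
  have lim: "(\<lambda>n. (1 / real n) *\<^sub>R f (plus_nfold z n z)) \<longlonglongrightarrow> f z" for z
    by (rule tendsto_plus_nfold[OF f_bound lim_avg])
  have "?c \<longlonglongrightarrow> f (x + y) - f x - f y"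
    unfolding scaleR_diff_right plus_nfold_add by (intro tendsto_diff lim)
  moreover have "?c \<longlonglongrightarrow> 0"
  proof (rule tendsto_0_le[where K = 1, OF lim_psi always_eventually], rule allI)
    fix n
    show "norm (?c n) \<le> norm (1 / real n * \<psi> (?X n) (?Y n)) * 1"
      \<comment> \<open>The comparison rule has a norm on the right, hence the passage to the
        absolute value of \<psi>.\<close>
      using order.trans[OF f_bound abs_ge_self] by (simp add: abs_mult divide_right_mono)
  qed
  ultimately have "f (x + y) - f x - f y = 0"
    by (rule LIMSEQ_unique)
  then show "f (x + y) = f x + f y"
    by (simp add: algebra_simps)
qed

end
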